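(* Let $A$ be a pseudo-BCI algebra and let $d:A\to A$ be a type I or a type II symmetric derivation on $A$. Then $d$ is regular (i.e. $d(1)=1$) if and only if every deductive system $D$ of $A$ satisfies $d(D)\subseteq D$.
   Context: A pseudo-BCI algebra is a structure $(A,\to,\rightsquigarrow,1)$ of type $(2,2,0)$ such that for all $x,y,z\in A$: $(x\to y)\rightsquigarrow[(y\to z)\rightsquigarrow(x\to z)]=1$; $(x\rightsquigarrow y)\to[(y\rightsquigarrow z)\to(x\rightsquigarrow z)]=1$; $1\to x=x$; $1\rightsquigarrow x=x$; and $x\to y=1$, $y\to x=1$ imply $x=y$. Put $x\Cup_1 y=(x\to y)\rightsquigarrow y$ and $x\Cup_2 y=(x\rightsquigarrow y)\to y$. A map $d:A\to A$ is a type I symmetric derivation if $d(x\to y)=(x\to d(y))\Cup_2(y\to d(x))$ and $d(x\rightsquigarrow y)=(x\rightsquigarrow d(y))\Cup_1(y\rightsquigarrow d(x))$ for all $x,y$; it is a type II symmetric derivation if $d(x\to y)=(d(x)\to y)\Cup_2(d(y)\to x)$ and $d(x\rightsquigarrow y)=(d(x)\rightsquigarrow y)\Cup_1(d(y)\rightsquigarrow x)$ for all $x,y$. A deductive system of $A$ is a subset $D\subseteq A$ with $1\in D$ such that $x\in D$ and $x\to y\in D$ imply $y\in D$. *)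

theory Defs
  imports "HOL-Algebra.Congruence"
begin

no_notation funcset (infixr "\<rightarrow>" 60)

record 'a pseudo_bci = "'a partial_object" +
  imp :: "'a \<Rightarrow> 'a \<Rightarrow> 'a" (infixr "\<rightarrow>\<index>" 65)
  wimp :: "'a \<Rightarrow> 'a \<Rightarrow> 'a" (infixr "\<leadsto>\<index>" 65)
  one :: 'a ("\<one>\<index>")

locale pseudo_bci_algebra =
  fixes A :: "('a, 'b) pseudo_bci_scheme" (structure)
  assumes imp_closed: "\<lbrakk>x \<in> carrier A; y \<in> carrier A\<rbrakk> \<Longrightarrow> x \<rightarrow> y \<in> carrier A"
    and wimp_closed: "\<lbrakk>x \<in> carrier A; y \<in> carrier A\<rbrakk> \<Longrightarrow> x \<leadsto> y \<in> carrier A"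
    and one_closed: "\<one> \<in> carrier A"
    and imp_trans: "\<lbrakk>x \<in> carrier A; y \<in> carrier A; z \<in> carrier A\<rbrakk>
      \<Longrightarrow> (x \<rightarrow> y) \<leadsto> ((y \<rightarrow> z) \<leadsto> (x \<rightarrow> z)) = \<one>"
    and wimp_trans: "\<lbrakk>x \<in> carrier A; y \<in> carrier A; z \<in> carrier A\<rbrakk>
      \<Longrightarrow> (x \<leadsto> y) \<rightarrow> ((y \<leadsto> z) \<rightarrow> (x \<leadsto> z)) = \<one>"
    and one_imp: "x \<in> carrier A \<Longrightarrow> \<one> \<rightarrow> x = x"
    and one_wimp: "x \<in> carrier A \<Longrightarrow> \<one> \<leadsto> x = x"
    and imp_antisym: "\<lbrakk>x \<in> carrier A; y \<in> carrier A; x \<rightarrow> y = \<one>; y \<rightarrow> x = \<one>\<rbrakk> \<Longrightarrow> x = y"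

definition cup1 :: "('a, 'b) pseudo_bci_scheme \<Rightarrow> 'a \<Rightarrow> 'a \<Rightarrow> 'a" (infixl "\<squnion>\<^sub>1\<index>" 60)
  where "x \<squnion>\<^sub>1\<^bsub>A\<^esub> y = (x \<rightarrow>\<^bsub>A\<^esub> y) \<leadsto>\<^bsub>A\<^esub> y"

definition cup2 :: "('a, 'b) pseudo_bci_scheme \<Rightarrow> 'a \<Rightarrow> 'a \<Rightarrow> 'a" (infixl "\<squnion>\<^sub>2\<index>" 60)
  where "x \<squnion>\<^sub>2\<^bsub>A\<^esub> y = (x \<leadsto>\<^bsub>A\<^esub> y) \<rightarrow>\<^bsub>A\<^esub> y"

definition symmetric_derivation_I :: "('a, 'b) pseudo_bci_scheme \<Rightarrow> ('a \<Rightarrow> 'a) \<Rightarrow> bool"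
  where "symmetric_derivation_I A d \<longleftrightarrow>
    (\<forall>x\<in>carrier A. d x \<in> carrier A) \<and>
    (\<forall>x\<in>carrier A. \<forall>y\<in>carrier A.
      d (x \<rightarrow>\<^bsub>A\<^esub> y) = (x \<rightarrow>\<^bsub>A\<^esub> d y) \<squnion>\<^sub>2\<^bsub>A\<^esub> (y \<rightarrow>\<^bsub>A\<^esub> d x) \<and>
      d (x \<leadsto>\<^bsub>A\<^esub> y) = (x \<leadsto>\<^bsub>A\<^esub> d y) \<squnion>\<^sub>1\<^bsub>A\<^esub> (y \<leadsto>\<^bsub>A\<^esub> d x))"

definition symmetric_derivation_II :: "('a, 'b) pseudo_bci_scheme \<Rightarrow> ('a \<Rightarrow> 'a) \<Rightarrow> bool"
  where "symmetric_derivation_II A d \<longleftrightarrow>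
    (\<forall>x\<in>carrier A. d x \<in> carrier A) \<and>
    (\<forall>x\<in>carrier A. \<forall>y\<in>carrier A.
      d (x \<rightarrow>\<^bsub>A\<^esub> y) = (d x \<rightarrow>\<^bsub>A\<^esub> y) \<squnion>\<^sub>2\<^bsub>A\<^esub> (d y \<rightarrow>\<^bsub>A\<^esub> x) \<and>
      d (x \<leadsto>\<^bsub>A\<^esub> y) = (d x \<leadsto>\<^bsub>A\<^esub> y) \<squnion>\<^sub>1\<^bsub>A\<^esub> (d y \<leadsto>\<^bsub>A\<^esub> x))"

definition regular :: "('a, 'b) pseudo_bci_scheme \<Rightarrow> ('a \<Rightarrow> 'a) \<Rightarrow> bool"
  where "regular A d \<longleftrightarrow> d \<one>\<^bsub>A\<^esub> = \<one>\<^bsub>A\<^esub>"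

definition deductive_system :: "('a, 'b) pseudo_bci_scheme \<Rightarrow> 'a set \<Rightarrow> bool"
  where "deductive_system A D \<longleftrightarrow>
    D \<subseteq> carrier A \<and> \<one>\<^bsub>A\<^esub> \<in> D \<and>
    (\<forall>x\<in>carrier A. \<forall>y\<in>carrier A. x \<in> D \<longrightarrow> x \<rightarrow>\<^bsub>A\<^esub> y \<in> D \<longrightarrow> y \<in> D)"

end

theory Submission
  imports Defs
begin

text \<open>Regularity is equivalent to \<open>d\<close> being inflationary:
  \<open>x \<rightarrow> d x = \<one>\<close> for all \<open>x\<close>. Given this, a deductive
  system, containing \<open>\<one>\<close> and closed under detachment, contains \<open>d x\<close>
  along with \<open>x\<close>. Conversely, \<open>{\<one>}\<close> is itself a deductive system, and
  its invariance says \<open>d \<one> = \<one>\<close>. Inflation is proved separately for the two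
  types, in \<open>symmetric_derivation_I_imp\<close> and
  \<open>symmetric_derivation_II_imp\<close>.\<close>

context pseudo_bci_algebra
begin

text \<open>Reflexivity is transitivity with two of the three arguments equal to
  \<open>\<one>\<close>, which the unit laws then cancel.\<close>

lemma imp_refl: "x \<in> carrier A \<Longrightarrow> x \<rightarrow> x = \<one>"
  using wimp_trans[of \<one> \<one> x] by (simp add: one_closed imp_closed one_imp one_wimp)

lemma wimp_refl: "x \<in> carrier A \<Longrightarrow> x \<leadsto> x = \<one>"
  using imp_trans[of \<one> \<one> x] by (simp add: one_closed wimp_closed one_imp one_wimp)

lemma cup2_idem: "x \<in> carrier A \<Longrightarrow> x \<squnion>\<^sub>2 x = x"
  by (simp add: cup2_def wimp_refl one_imp)

text \<open>Transitivity of \<open>\<leadsto>\<close> started at \<open>\<one>\<close>, where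
  \<open>\<one> \<leadsto> x\<close> and \<open>\<one> \<leadsto> y\<close> collapse to
  \<open>x\<close> and \<open>y\<close>.\<close>

lemma imp_cup2:
  assumes "x \<in> carrier A" "y \<in> carrier A"
  shows "x \<rightarrow> (x \<squnion>\<^sub>2 y) = \<one>"
  using wimp_trans[of \<one> x y] assms by (simp add: cup2_def one_closed one_wimp)

lemma deductive_system_singleton_one: "deductive_system A {\<one>}"
  by (auto simp: deductive_system_def one_closed one_imp)

text \<open>Apply the derivation law to \<open>x \<rightarrow> x = \<one>\<close>: both joinands
  equal \<open>x \<rightarrow> d x\<close>, so idempotence gives
  \<open>d \<one> = x \<rightarrow> d x\<close>.\<close>

lemma symmetric_derivation_I_imp:
  assumes "symmetric_derivation_I A d" "regular A d" "x \<in> carrier A"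
  shows "x \<rightarrow> d x = \<one>"
proof -
  have "d x \<in> carrier A" and "d (x \<rightarrow> x) = (x \<rightarrow> d x) \<squnion>\<^sub>2 (x \<rightarrow> d x)"
    using assms by (auto simp: symmetric_derivation_I_def)
  then show ?thesis
    using assms by (simp add: regular_def imp_refl cup2_idem imp_closed)
qed

text \<open>Here the law is applied to \<open>\<one> \<rightarrow> x = x\<close>. As
  \<open>d \<one> = \<one>\<close>, it exhibits \<open>d x\<close> as a
  \<open>\<squnion>\<^sub>2\<close> with left argument \<open>x\<close>, hence above
  \<open>x\<close>.\<close>

lemma symmetric_derivation_II_imp:
  assumes "symmetric_derivation_II A d" "regular A d" "x \<in> carrier A"
  shows "x \<rightarrow> d x = \<one>"
proof -
  have dx: "d x \<in> carrier A" and "d (\<one> \<rightarrow> x) = (d \<one> \<rightarrow> x) \<squnion>\<^sub>2 (d x \<rightarrow> \<one>)"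
    using assms one_closed by (auto simp: symmetric_derivation_II_def)
  then have "d x = x \<squnion>\<^sub>2 (d x \<rightarrow> \<one>)"
    using assms by (simp add: regular_def one_imp)
  then show ?thesis
    using imp_cup2[of x "d x \<rightarrow> \<one>"] assms dx by (simp add: imp_closed one_closed)
qed

end

theorem theorem5p15:
  fixes A :: "('a, 'b) pseudo_bci_scheme"
    and d :: "'a \<Rightarrow> 'a"
  assumes "pseudo_bci_algebra A"
    and "symmetric_derivation_I A d \<or> symmetric_derivation_II A d"
  shows "regular A d \<longleftrightarrow> (\<forall>D. deductive_system A D \<longrightarrow> d ` D \<subseteq> D)"
proof -
  interpret pseudo_bci_algebra A by fact
  have closed: "d x \<in> carrier A" if "x \<in> carrier A" for x
    using assms(2) that by (auto simp: symmetric_derivation_I_def symmetric_derivation_II_def)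
  show ?thesis
  proof
    assume "regular A d"
    then have "x \<rightarrow>\<^bsub>A\<^esub> d x = \<one>\<^bsub>A\<^esub>" if "x \<in> carrier A" for x
      using assms(2) that symmetric_derivation_I_imp symmetric_derivation_II_imp by blast
    then show "\<forall>D. deductive_system A D \<longrightarrow> d ` D \<subseteq> D"
      \<comment> \<open>Detachment from \<open>x\<close> and
        \<open>x \<rightarrow> d x = \<one>\<close>, both in \<open>D\<close>.\<close>
      using closed unfolding deductive_system_def by (metis image_subsetI subsetD)
  next
    assume "\<forall>D. deductive_system A D \<longrightarrow> d ` D \<subseteq> D"
    then have "d ` {\<one>\<^bsub>A\<^esub>} \<subseteq> {\<one>\<^bsub>A\<^esub>}"
      using deductive_system_singleton_one by blast
    then show "regular A d"
      by (simp add: regular_def)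
  qed
qed

end
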